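(* Let $K$ be a field, $G$ a group, and let the associative algebra $UT_n$ of upper triangular $n\times n$ matrices over $K$ be endowed with any $G$-grading $\Gamma$. Then $\mathrm{Aut}(\Gamma)=\mathrm{Stab}(\Gamma)$ and $W(\Gamma)=1$.
   Context: A $G$-grading $\Gamma$ on an algebra $A$ is a vector space decomposition $A=\bigoplus_{g\in G}A_g$ with $A_gA_h\subset A_{gh}$ for all $g,h\in G$; $\mathrm{Supp}\,\Gamma=\{g\in G\mid A_g\neq 0\}$. $\mathrm{Aut}(\Gamma)$ is the group of self-equivalences: algebra automorphisms $f$ of $A$ such that for every $g\in\mathrm{Supp}\,\Gamma$ there is $h\in\mathrm{Supp}\,\Gamma$ with $f(A_g)=A_h$. $\mathrm{Stab}(\Gamma)$ is the (normal) subgroup of graded automorphisms, i.e. those $f$ with $f(A_g)=A_g$ for all $g$. $W(\Gamma)=\mathrm{Aut}(\Gamma)/\mathrm{Stab}(\Gamma)$ is the Weyl group. *)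

theory Defs
  imports "HOL-Algebra.Algebra" "Jordan_Normal_Form.Matrix"
begin

text \<open>
  An associative algebra over a field of type \<open>'k\<close> is represented by an HOL-Algebra \<open>module\<close> record,
  whose multiplication \<open>\<otimes>\<close> need not be commutative; the library locale \<open>algebra\<close> assumes
  commutativity and is therefore not used.
\<close>

definition UT_alg :: "nat \<Rightarrow> ('k::field, 'k mat) module" where
  "UT_alg n =
     module_mat TYPE('k) n n \<lparr>carrier := {A \<in> carrier_mat n n. upper_triangular A}\<rparr>"

lemma UT_alg_simps:
  "carrier (UT_alg n :: ('k::field, 'k mat) module) = {A \<in> carrier_mat n n. upper_triangular A}"
  "monoid.mult (UT_alg n :: ('k, 'k mat) module) = (*)"
  "monoid.one (UT_alg n :: ('k, 'k mat) module) = 1\<^sub>m n"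
  "ring.zero (UT_alg n :: ('k, 'k mat) module) = 0\<^sub>m n n"
  "ring.add (UT_alg n :: ('k, 'k mat) module) = (+)"
  "module.smult (UT_alg n :: ('k, 'k mat) module) = (\<cdot>\<^sub>m)"
  by (simp_all add: UT_alg_def module_mat_def)

lemma ring_UT_alg: "ring (UT_alg n :: ('k::field, 'k mat) module)"
proof (rule ringI)
  show "abelian_group (UT_alg n :: ('k, 'k mat) module)"
  proof (rule abelian_groupI)
    fix A :: "'k mat" assume A: "A \<in> carrier (UT_alg n)"
    show "\<exists>B\<in>carrier (UT_alg n). B \<oplus>\<^bsub>UT_alg n\<^esub> A = \<zero>\<^bsub>UT_alg n\<^esub>"
      using A by (intro bexI[of _ "- A"]) (auto simp: UT_alg_simps upper_triangular_def)
  qed (auto simp: UT_alg_simps upper_triangular_def)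
  show "monoid (UT_alg n :: ('k, 'k mat) module)"
  proof (rule monoidI)
    fix A B :: "'k mat" assume A: "A \<in> carrier (UT_alg n)" and B: "B \<in> carrier (UT_alg n)"
    have "(A * B) $$ (i, j) = 0" if "i < n" "j < i" for i j
      using A B that
      by (auto simp: UT_alg_simps upper_triangular_def scalar_prod_def intro!: sum.neutral)
        (metis linorder_neqE_nat order_less_trans)
    then show "A \<otimes>\<^bsub>UT_alg n\<^esub> B \<in> carrier (UT_alg n)"
      using A B by (auto simp: UT_alg_simps upper_triangular_def)
  qed (auto simp: UT_alg_simps)
qed (auto simp: UT_alg_simps add_mult_distrib_mat mult_add_distrib_mat)

definition alg_subspace :: "('k::field, 'a) module \<Rightarrow> 'a set \<Rightarrow> bool" where
  "alg_subspace A V \<longleftrightarrow>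
     V \<subseteq> carrier A \<and> \<zero>\<^bsub>A\<^esub> \<in> V \<and>
     (\<forall>x\<in>V. \<forall>y\<in>V. x \<oplus>\<^bsub>A\<^esub> y \<in> V) \<and>
     (\<forall>c. \<forall>x\<in>V. c \<odot>\<^bsub>A\<^esub> x \<in> V)"

text \<open>
  Directness: every element is the sum of exactly one finitely supported family of homogeneous
  elements. The sum is taken over the support of the family, since \<open>finsum\<close> over an infinite
  index set is zero by convention.
\<close>

definition alg_grading ::
  "('g, 'm) monoid_scheme \<Rightarrow> ('k::field, 'a) module \<Rightarrow> ('g \<Rightarrow> 'a set) \<Rightarrow> bool" where
  "alg_grading G A \<Gamma> \<longleftrightarrow>
     (\<forall>g\<in>carrier G. alg_subspace A (\<Gamma> g)) \<and>
     (\<forall>a\<in>carrier A. \<exists>!x. x \<in> (\<Pi>\<^sub>E g\<in>carrier G. \<Gamma> g) \<and>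
        finite {g \<in> carrier G. x g \<noteq> \<zero>\<^bsub>A\<^esub>} \<and>
        a = finsum A x {g \<in> carrier G. x g \<noteq> \<zero>\<^bsub>A\<^esub>}) \<and>
     (\<forall>g\<in>carrier G. \<forall>h\<in>carrier G. \<forall>x\<in>\<Gamma> g. \<forall>y\<in>\<Gamma> h.
        x \<otimes>\<^bsub>A\<^esub> y \<in> \<Gamma> (g \<otimes>\<^bsub>G\<^esub> h))"

definition grading_supp ::
  "('g, 'm) monoid_scheme \<Rightarrow> ('k::field, 'a) module \<Rightarrow> ('g \<Rightarrow> 'a set) \<Rightarrow> 'g set" where
  "grading_supp G A \<Gamma> = {g \<in> carrier G. \<Gamma> g \<noteq> {\<zero>\<^bsub>A\<^esub>}}"

definition alg_auto :: "('k::field, 'a) module \<Rightarrow> ('a \<Rightarrow> 'a) set" where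
  "alg_auto A = {f \<in> Ring.ring_hom A A \<inter> Bij (carrier A).
     \<forall>c. \<forall>x\<in>carrier A. f (c \<odot>\<^bsub>A\<^esub> x) = c \<odot>\<^bsub>A\<^esub> f x}"

definition grading_Aut ::
  "('g, 'm) monoid_scheme \<Rightarrow> ('k::field, 'a) module \<Rightarrow> ('g \<Rightarrow> 'a set) \<Rightarrow> ('a \<Rightarrow> 'a) set" where
  "grading_Aut G A \<Gamma> = {f \<in> alg_auto A.
     \<forall>g\<in>grading_supp G A \<Gamma>. \<exists>h\<in>grading_supp G A \<Gamma>. f ` \<Gamma> g = \<Gamma> h}"

definition grading_Stab ::
  "('g, 'm) monoid_scheme \<Rightarrow> ('k::field, 'a) module \<Rightarrow> ('g \<Rightarrow> 'a set) \<Rightarrow> ('a \<Rightarrow> 'a) set" where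
  "grading_Stab G A \<Gamma> = {f \<in> alg_auto A. \<forall>g\<in>carrier G. f ` \<Gamma> g = \<Gamma> g}"

definition grading_AutGroup ::
  "('g, 'm) monoid_scheme \<Rightarrow> ('k::field, 'a) module \<Rightarrow> ('g \<Rightarrow> 'a set) \<Rightarrow> ('a \<Rightarrow> 'a) monoid" where
  "grading_AutGroup G A \<Gamma> = BijGroup (carrier A) \<lparr>carrier := grading_Aut G A \<Gamma>\<rparr>"

definition Weyl_group ::
  "('g, 'm) monoid_scheme \<Rightarrow> ('k::field, 'a) module \<Rightarrow> ('g \<Rightarrow> 'a set) \<Rightarrow> ('a \<Rightarrow> 'a) set monoid" where
  "Weyl_group G A \<Gamma> = grading_AutGroup G A \<Gamma> Mod grading_Stab G A \<Gamma>"

end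

theory Submission
  imports Defs
begin

text \<open>
  Write \<open>A = UT\<^sub>n\<close>, \<open>J\<close> for the strictly upper triangular matrices and \<open>\<chi>\<^sub>i\<close> for the character
  reading off the \<open>i\<close>-th diagonal entry. An algebra automorphism \<open>f\<close> preserves every
  \<open>\<chi>\<^sub>i\<close> (\<open>alg_auto_diag\<close>). So if the degree-one piece contains, for each \<open>i\<close>,
  an idempotent \<open>u\<^sub>i\<close> with diagonal \<open>e\<^sub>i\<^sub>i\<close>, then \<open>u\<^sub>i\<close> and
  \<open>v\<^sub>i = f u\<^sub>i\<close> are two such idempotents. The corners \<open>u\<^sub>i A u\<^sub>j\<close> are at most
  one-dimensional, hence homogeneous, and \<open>v\<^sub>i u\<^sub>i v\<^sub>i = v\<^sub>i\<close>. Given \<open>f (A\<^sub>g) = A\<^sub>h\<close>,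
  choose \<open>a \<in> A\<^sub>g\<close> and \<open>i, j\<close> with \<open>b = u\<^sub>i a u\<^sub>j \<noteq> 0\<close>. Multiplying the nonzero
  element \<open>u\<^sub>i (f b) u\<^sub>j\<close> by \<open>v\<^sub>i\<close> and \<open>v\<^sub>j\<close> gives back \<open>f b\<close>, so it is
  nonzero; it has degree \<open>h\<close> and lies on the line spanned by \<open>b\<close>, of degree \<open>g\<close>.
  Therefore \<open>g = h\<close>.

  The existence of the \<open>u\<^sub>i\<close> is where the structure of the grading enters, and it follows from
  the claim that a homogeneous matrix with a nonzero diagonal entry has degree one
  (\<open>diag_nonzero_imp_degree_one\<close>): the degree-one component of \<open>e\<^sub>i\<^sub>i\<close> then has the same
  diagonal as \<open>e\<^sub>i\<^sub>i\<close>, and its \<open>n\<close>-th power is idempotent.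

  For the claim, one first shows that \<open>J\<close> is a graded ideal. The map
  \<open>a \<mapsto> (g \<mapsto> \<chi>\<^sub>i (a\<^sub>g))\<close> is a homomorphism from \<open>UT\<^sub>n\<close> into the group algebra of
  \<open>G\<close>, whose image is the group algebra of a finite subgroup; call its kernel \<open>I\<close>. If \<open>J\<close>
  were not contained in \<open>I\<close>, there would be a matrix unit \<open>e\<^sub>k\<^sub>l \<notin> I\<close> with \<open>l - k > 0\<close> as large as possible. Modulo \<open>I\<close>, left multiplication of
  \<open>e\<^sub>k\<^sub>l\<close> by \<open>x\<close> is then multiplication by \<open>\<chi>\<^sub>k x\<close>, and right multiplication is
  multiplication by \<open>\<chi>\<^sub>l x\<close>. Up to scalars, an element of the group algebra of a finite group that
  spans a one-dimensional left ideal is determined by the character through which the group acts on it,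
  and the group acts on it from the right through the same character. This yields
  \<open>\<chi>\<^sub>k = \<chi>\<^sub>l\<close>, which is absurd (\<open>components_diag_zero_step\<close>). Since this holds for
  every \<open>i\<close>, homogeneous components of elements of \<open>J\<close> lie in \<open>J\<close>.

  Consequently, there are homogeneous \<open>L \<in> J\<^sup>i\<close> and \<open>R \<in> J\<^bsup>n-1-i\<^esup>\<close> (rows and columns
  counted from zero) such that \<open>L R\<close> is a nonzero multiple of the corner matrix unit. For every \<open>x\<close>
  one has \<open>L x R = \<chi>\<^sub>i x \<cdot> L R\<close>, so if \<open>x\<close> is homogeneous and \<open>\<chi>\<^sub>i x \<noteq> 0\<close>, comparing
  degrees forces \<open>x\<close> to have degree one. The same sandwich, built from the images of matrix units,
  shows that automorphisms preserve \<open>\<chi>\<^sub>i\<close>.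
\<close>

section \<open>Matrices supported on high superdiagonals\<close>

text \<open>
  This is the radical filtration: the upper triangular matrices for \<open>m = 0\<close>, the \<open>m\<close>-th power of
  their Jacobson radical for \<open>m \<ge> 1\<close>, and \<open>0\<close> from \<open>m = n\<close> on.
\<close>

definition band :: "nat \<Rightarrow> nat \<Rightarrow> 'k::field mat set" where
  "band n m = {M \<in> carrier_mat n n. \<forall>a<n. \<forall>b<n. b < a + m \<longrightarrow> M $$ (a, b) = 0}"

definition matrix_unit :: "nat \<Rightarrow> nat \<Rightarrow> nat \<Rightarrow> 'k::field mat" where
  "matrix_unit n k l = mat n n (\<lambda>p. if p = (k, l) then 1 else 0)"

lemma carrier_UT_alg: "carrier (UT_alg n) = band n 0"
  by (auto simp: UT_alg_simps band_def upper_triangular_def)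

lemma band_carrier: "M \<in> band n m \<Longrightarrow> M \<in> carrier_mat n n"
  by (simp add: band_def)

lemma band_entry: "M \<in> band n m \<Longrightarrow> b < a + m \<Longrightarrow> a < n \<Longrightarrow> b < n \<Longrightarrow> M $$ (a, b) = 0"
  by (simp add: band_def)

lemma band_mono: "M \<in> band n m \<Longrightarrow> m' \<le> m \<Longrightarrow> M \<in> band n m'"
  by (auto simp: band_def)

lemma band_SucI:
  assumes "M \<in> band n m" and "\<And>a. a + m < n \<Longrightarrow> M $$ (a, a + m) = 0"
  shows "M \<in> band n (Suc m)"
  using assms by (auto simp: band_def less_Suc_eq)

lemma band_size: "M \<in> band n n \<Longrightarrow> M = 0\<^sub>m n n"
  by (rule eq_matI) (auto simp: band_def)

lemma zero_in_band [simp]: "0\<^sub>m n n \<in> band n m"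
  by (auto simp: band_def)

lemma one_in_band [simp]: "1\<^sub>m n \<in> band n 0"
  by (auto simp: band_def)

lemma band_add: "M \<in> band n m \<Longrightarrow> N \<in> band n m \<Longrightarrow> M + N \<in> band n m"
  by (auto simp: band_def)

lemma band_diff: "M \<in> band n m \<Longrightarrow> N \<in> band n m \<Longrightarrow> M - N \<in> band n m"
  by (auto simp: band_def minus_carrier_mat)

lemma band_smult: "M \<in> band n m \<Longrightarrow> c \<cdot>\<^sub>m M \<in> band n m"
  by (auto simp: band_def)

lemma mult_entry:
  "M \<in> carrier_mat n n \<Longrightarrow> N \<in> carrier_mat n n \<Longrightarrow> a < n \<Longrightarrow> b < n \<Longrightarrow>
    (M * N) $$ (a, b) = (\<Sum>c<n. M $$ (a, c) * N $$ (c, b))"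
  by (auto simp: scalar_prod_def lessThan_atLeast0 intro!: sum.cong)

lemma square_mat_eqI:
  "M \<in> carrier_mat n n \<Longrightarrow> N \<in> carrier_mat n n \<Longrightarrow>
    (\<And>a b. a < n \<Longrightarrow> b < n \<Longrightarrow> M $$ (a, b) = N $$ (a, b)) \<Longrightarrow> M = N"
  by (rule eq_matI) auto

lemma diff_entry:
  "N \<in> carrier_mat n n \<Longrightarrow> a < n \<Longrightarrow> b < n \<Longrightarrow> (M - N) $$ (a, b) = M $$ (a, b) - N $$ (a, b)"
  by auto

lemma smult_entry:
  "M \<in> carrier_mat n n \<Longrightarrow> a < n \<Longrightarrow> b < n \<Longrightarrow> (c \<cdot>\<^sub>m M) $$ (a, b) = c * M $$ (a, b)"
  by auto

lemma band_mult:
  assumes M: "M \<in> band n p" and N: "N \<in> band n q"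
  shows "M * N \<in> band n (p + q)"
proof -
  have "(M * N) $$ (a, b) = 0" if "a < n" "b < n" "b < a + (p + q)" for a b
  proof -
    have "M $$ (a, c) * N $$ (c, b) = 0" if "c < n" for c
      using band_entry[OF M, of c a] band_entry[OF N, of b c] that \<open>a < n\<close> \<open>b < n\<close> \<open>b < a + (p + q)\<close>
      by (cases "c < a + p") auto
    then have "(\<Sum>c<n. M $$ (a, c) * N $$ (c, b)) = 0"
      by (intro sum.neutral) auto
    then show ?thesis
      using that M N by (simp add: mult_entry[of _ n] band_carrier)
  qed
  then show ?thesis using M N by (auto simp: band_def)
qed

text \<open>
  On the lowest superdiagonal that may be nonzero, multiplication is entrywise: this is the
  associated graded algebra of the radical filtration, and all nonvanishing arguments below take place
  there.
\<close>

lemma band_mult_edge: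
  assumes M: "M \<in> band n p" and N: "N \<in> band n q" and b: "b = a + p + q" "b < n"
  shows "(M * N) $$ (a, b) = M $$ (a, a + p) * N $$ (a + p, b)"
proof -
  have "(M * N) $$ (a, b) = (\<Sum>c<n. M $$ (a, c) * N $$ (c, b))"
    using M N b by (simp add: mult_entry[of _ n] band_carrier)
  also have "\<dots> = (\<Sum>c\<in>{a + p}. M $$ (a, c) * N $$ (c, b))"
  proof (rule sum.mono_neutral_right)
    show "\<forall>c\<in>{..<n} - {a + p}. M $$ (a, c) * N $$ (c, b) = 0"
    proof
      fix c assume c: "c \<in> {..<n} - {a + p}"
      then show "M $$ (a, c) * N $$ (c, b) = 0"
        using band_entry[OF M, of c a] band_entry[OF N, of b c] b
        by (cases "c < a + p") auto
    qed
  qed (use b in auto)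
  finally show ?thesis by simp
qed

lemma diag_mult:
  "M \<in> band n 0 \<Longrightarrow> N \<in> band n 0 \<Longrightarrow> a < n \<Longrightarrow> (M * N) $$ (a, a) = M $$ (a, a) * N $$ (a, a)"
  using band_mult_edge[of M n 0 N 0 a a] by simp

lemma matrix_unit_band: "k + m \<le> l \<Longrightarrow> matrix_unit n k l \<in> band n m"
  by (auto simp: band_def matrix_unit_def)

lemma matrix_unit_carrier [simp]: "matrix_unit n k l \<in> carrier_mat n n"
  by (simp add: matrix_unit_def)

lemma matrix_unit_entry:
  "a < n \<Longrightarrow> b < n \<Longrightarrow> matrix_unit n k l $$ (a, b) = (if a = k \<and> b = l then 1 else 0)"
  by (simp add: matrix_unit_def)

lemma matrix_unit_sandwich:
  assumes M: "M \<in> carrier_mat n n" and "i < n" "j < n" "a < n" "b < n"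
  shows "matrix_unit n a i * M * matrix_unit n j b = M $$ (i, j) \<cdot>\<^sub>m matrix_unit n a b"
proof (rule eq_matI)
  fix r s assume "r < dim_row (M $$ (i, j) \<cdot>\<^sub>m matrix_unit n a b)"
    and "s < dim_col (M $$ (i, j) \<cdot>\<^sub>m matrix_unit n a b)"
  then have rs: "r < n" "s < n" by (auto simp: matrix_unit_def)
  have *: "(matrix_unit n a i * M) $$ (r, c) = (if r = a then M $$ (i, c) else 0)" if "c < n" for c
    using that rs assms
    by (simp add: mult_entry[of _ n] matrix_unit_entry if_distrib[of "\<lambda>x. x * _"] cong: if_cong)
  show "(matrix_unit n a i * M * matrix_unit n j b) $$ (r, s)
      = (M $$ (i, j) \<cdot>\<^sub>m matrix_unit n a b) $$ (r, s)"
    using rs assms *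
    by (simp add: mult_entry[of _ n] mult_carrier_mat[of _ n n] matrix_unit_entry
        if_distrib[of "\<lambda>x. _ * x"] cong: if_cong) (simp add: matrix_unit_def)
qed (use M in \<open>auto simp: matrix_unit_def\<close>)

lemma smult_one: "(1::'k::field) \<cdot>\<^sub>m M = M"
  by (rule eq_matI) auto

lemma matrix_unit_mult:
  assumes "i < n" "j < n" "a < n" "b < n"
  shows "matrix_unit n a i * matrix_unit n j b = (if i = j then matrix_unit n a b else 0\<^sub>m n n)"
proof -
  have "matrix_unit n a i * matrix_unit n j b = 1\<^sub>m n $$ (i, j) \<cdot>\<^sub>m matrix_unit n a b"
    using matrix_unit_sandwich[of "1\<^sub>m n" n i j a b] assms
    by (simp add: right_mult_one_mat[of _ n n])
  also have "\<dots> = (if i = j then matrix_unit n a b else 0\<^sub>m n n)"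
    using assms by (intro square_mat_eqI[of _ n]) (auto simp: carrier_matD[OF matrix_unit_carrier])
  finally show ?thesis .
qed

lemma top_band_eqI:
  assumes "M \<in> band n (n - 1)" "N \<in> band n (n - 1)"
    and "0 < n \<Longrightarrow> M $$ (0, n - 1) = N $$ (0, n - 1)"
  shows "M = N"
proof (rule square_mat_eqI)
  fix a b assume ab: "a < n" "b < n"
  show "M $$ (a, b) = N $$ (a, b)"
  proof (cases "b < a + (n - 1)")
    case False
    then have "a = 0" "b = n - 1" using ab by auto
    then show ?thesis using assms(3) ab by simp
  qed (use band_entry[OF assms(1), of b a] band_entry[OF assms(2), of b a] ab in simp)
qed (use assms band_carrier in auto)

text \<open>
  The \<open>(n-1)\<close>-st power of the radical is spanned by the corner matrix unit, so a product ending
  there is determined by one entry. This exhibits the \<open>i\<close>-th diagonal entry as the scalar by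
  which \<open>x\<close> acts when placed between \<open>L\<close> and \<open>R\<close>.
\<close>

lemma top_band_sandwich:
  assumes L: "L \<in> band n i" and R: "R \<in> band n (n - 1 - i)" and x: "x \<in> band n 0" and i: "i < n"
  shows "L * x * R = x $$ (i, i) \<cdot>\<^sub>m (L * R)"
    and "(L * R) $$ (0, n - 1) = L $$ (0, i) * R $$ (i, n - 1)"
proof -
  have Lx: "L * x \<in> band n i" using band_mult[OF L x] by simp
  have n: "i + (n - 1 - i) = n - 1" using i by simp
  have LR: "L * R \<in> band n (n - 1)" and LxR: "L * x * R \<in> band n (n - 1)"
    using band_mult[OF L R] band_mult[OF Lx R] n by simp_all
  show *: "(L * R) $$ (0, n - 1) = L $$ (0, i) * R $$ (i, n - 1)"
    using band_mult_edge[OF L R, of "n - 1" 0] i by simp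
  have "(L * x * R) $$ (0, n - 1) = (L * x) $$ (0, i) * R $$ (i, n - 1)"
    using band_mult_edge[OF Lx R, of "n - 1" 0] i by simp
  also have "(L * x) $$ (0, i) = L $$ (0, i) * x $$ (i, i)"
    using band_mult_edge[OF L x, of i 0] i by simp
  finally have "(L * x * R) $$ (0, n - 1) = x $$ (i, i) * (L * R) $$ (0, n - 1)"
    using * by simp
  then show "L * x * R = x $$ (i, i) \<cdot>\<^sub>m (L * R)"
    using i by (intro top_band_eqI[OF LxR band_smult[OF LR]]) (simp add: smult_entry[OF band_carrier[OF LR]])
qed

section \<open>Primitive idempotents\<close>

text \<open>
  An idempotent in the radical lies in all of its powers.
\<close>

lemma strictly_upper_idempotent:
  assumes "x \<in> band n 1" and "x * x = x"
  shows "x = 0\<^sub>m n n"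
proof -
  have "x \<in> band n (Suc m)" for m
    by (induction m) (use assms band_mult[of x n _ x 1] in \<open>auto\<close>)
  then show ?thesis using band_mono[of x n "Suc n" n] band_size by auto
qed

text \<open>
  The idempotents lifting the class of \<open>e\<^sub>i\<^sub>i\<close> modulo the radical.
\<close>

definition primitive_at :: "nat \<Rightarrow> nat \<Rightarrow> 'k::field mat \<Rightarrow> bool" where
  "primitive_at n i u \<longleftrightarrow>
     u \<in> band n 0 \<and> u * u = u \<and> (\<forall>a<n. u $$ (a, a) = (if a = i then 1 else 0))"

lemma band_assoc:
  "x \<in> band n p \<Longrightarrow> y \<in> band n q \<Longrightarrow> z \<in> band n r \<Longrightarrow> x * y * z = x * (y * z)"
  by (rule assoc_mult_mat[of _ n n _ n _ n]) (auto dest: band_carrier)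

text \<open>
  Write \<open>e = e\<^sub>i\<^sub>i\<close>. From \<open>e u e = e\<close> it follows that \<open>w = u e u\<close> is an idempotent of the
  corner \<open>u A u\<close>, so \<open>u - w\<close> is an idempotent as well; it has zero diagonal and therefore vanishes.
\<close>

lemma primitive_at_factor:
  assumes u: "primitive_at n i u" and i: "i < n"
  shows "u * matrix_unit n i i * u = u"
proof -
  let ?e = "matrix_unit n i i :: 'a mat"
  have ub: "u \<in> band n 0" and uu: "u * u = u" and ui: "u $$ (i, i) = 1"
    using u i by (auto simp: primitive_at_def)
  have e: "?e \<in> band n 0" by (simp add: matrix_unit_band)
  have eue: "?e * u * ?e = ?e"
    using matrix_unit_sandwich[of u n i i i i] ub i ui by (auto simp: band_carrier)
  have bm: "x * y \<in> band n 0" if "x \<in> band n 0" "y \<in> band n 0" for x y :: "'a mat"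
    using band_mult[OF that] by simp
  define w where "w = u * ?e * u"
  have w: "w \<in> band n 0" using ub e bm by (simp add: w_def)
  have uw: "u * w = w" and wu: "w * u = w"
    using uu ub e bm by (simp_all add: w_def band_assoc[of _ n 0 _ 0 _ 0])
       (simp_all flip: band_assoc[of _ n 0 _ 0 _ 0])
  have "w * w = u * (?e * u * ?e) * u"
    using uu ub e bm by (simp add: w_def band_assoc[of _ n 0 _ 0 _ 0])
       (metis band_assoc)
  then have ww: "w * w = w" using eue by (simp add: w_def)
  have "(u - w) * (u - w) = u * u - u * w - (w * u - w * w)"
  proof -
    have c: "u \<in> carrier_mat n n" "w \<in> carrier_mat n n" using ub w by (auto intro: band_carrier)
    have "(u - w) * (u - w) = u * (u - w) - w * (u - w)"
      using c by (intro minus_mult_distrib_mat[of _ n n _ _ n]) (auto intro: minus_carrier_mat)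
    then show ?thesis
      using c by (simp add: mult_minus_distrib_mat[of _ n n _ n])
  qed
  also have "\<dots> = u - w"
    using ub w unfolding uu uw wu ww by (intro eq_matI) (auto dest!: band_carrier)
  finally have idem: "(u - w) * (u - w) = u - w" .
  have "(u - w) $$ (a, a) = 0" if "a < n" for a
  proof -
    have "w $$ (a, a) = u $$ (a, a) * ?e $$ (a, a) * u $$ (a, a)"
      unfolding w_def diag_mult[OF bm[OF ub e] ub that] diag_mult[OF ub e that] ..
    also have "\<dots> = u $$ (a, a)"
      using that u by (simp add: primitive_at_def matrix_unit_entry)
    finally show ?thesis using that carrier_matD[OF band_carrier[OF w]] by simp
  qed
  then have "u - w \<in> band n (Suc 0)"
    using ub w by (intro band_SucI band_diff) auto
  then have "u - w = 0\<^sub>m n n"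
    using idem strictly_upper_idempotent by simp
  then have "\<And>a b. a < n \<Longrightarrow> b < n \<Longrightarrow> u $$ (a, b) - w $$ (a, b) = 0"
    using ub w by (metis band_carrier carrier_matD index_minus_mat(1) index_zero_mat(1))
  then show ?thesis unfolding w_def[symmetric]
    using ub w by (intro eq_matI) (auto dest!: band_carrier)
qed

text \<open>
  Each of the idempotents factors through a diagonal matrix unit, and \<open>e\<^sub>i\<^sub>i M e\<^sub>j\<^sub>j\<close> is a multiple of
  \<open>e\<^sub>i\<^sub>j\<close>. So the corner between them is at most one-dimensional.
\<close>

lemma primitive_corner:
  assumes u: "primitive_at n i u" and w: "primitive_at n j w" and ij: "i < n" "j < n"
    and x: "x \<in> band n 0"
  shows "u * x * w = (u * x * w) $$ (i, j) \<cdot>\<^sub>m (u * matrix_unit n i j * w)"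
proof -
  let ?e = "matrix_unit n i i :: 'a mat" and ?d = "matrix_unit n j j :: 'a mat"
  have ub: "u \<in> carrier_mat n n" and wb: "w \<in> carrier_mat n n" and xb: "x \<in> carrier_mat n n"
    using u w x by (auto simp: primitive_at_def band_carrier)
  define y where "y = u * x * w"
  have y: "y \<in> carrier_mat n n" using ub wb xb by (simp add: y_def)
  note as = assoc_mult_mat[of _ n n _ n _ n] mult_carrier_mat[of _ n n]
  have "y = (u * ?e * u) * x * (w * ?d * w)"
    using primitive_at_factor[OF u ij(1)] primitive_at_factor[OF w ij(2)] by (simp add: y_def)
  also have "\<dots> = u * (?e * y * ?d) * w"
    using ub wb xb by (simp add: y_def as)
  also have "?e * y * ?d = y $$ (i, j) \<cdot>\<^sub>m matrix_unit n i j"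
    using matrix_unit_sandwich[OF y ij ij] .
  finally show ?thesis
    unfolding y_def[symmetric] using ub wb
    by (simp add: mult_smult_distrib[of _ n n _ n] mult_smult_assoc_mat[of _ n n _ n]
        mult_carrier_mat[of _ n n])
qed

text \<open>
  The corner \<open>v A v\<close> is the line through \<open>v\<close>, and the \<open>i\<close>-th diagonal entry identifies the scalar
  as \<open>1\<close>. This lets one pass between the corners of \<open>u\<close> and of \<open>v\<close> without loss.
\<close>

lemma primitive_sandwich:
  assumes u: "primitive_at n i u" and v: "primitive_at n i v" and i: "i < n"
  shows "v * u * v = v"
proof -
  let ?e = "matrix_unit n i i :: 'a mat"
  have b: "u \<in> band n 0" "v \<in> band n 0" "v * u \<in> band n 0"
    using u v band_mult[of v n 0 u 0] by (auto simp: primitive_at_def)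
  have "(v * u * v) $$ (i, i) = 1"
    using b u v i by (simp add: diag_mult primitive_at_def)
  then have "v * u * v = 1 \<cdot>\<^sub>m (v * ?e * v)"
    using primitive_corner[OF v v i i b(1)] by simp
  then show ?thesis
    using primitive_at_factor[OF v i] by (metis smult_one)
qed

text \<open>
  On the last nonzero row of \<open>a\<close>, left multiplication by the corresponding idempotent acts as the
  identity, and then on the first nonzero entry of that row right multiplication does.
\<close>

lemma nonzero_corner:
  assumes a: "a \<in> band n 0" "a \<noteq> 0\<^sub>m n n" and u: "\<And>i. i < n \<Longrightarrow> primitive_at n i (u i)"
  shows "\<exists>i<n. \<exists>j<n. u i * a * u j \<noteq> 0\<^sub>m n n"
proof -
  have ac: "a \<in> carrier_mat n n" using a by (simp add: band_carrier)
  have uc: "u i \<in> carrier_mat n n" if "i < n" for i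
    using u[OF that] band_carrier by (auto simp: primitive_at_def)
  define R where "R = {r. r < n \<and> (\<exists>s<n. a $$ (r, s) \<noteq> 0)}"
  have "R \<noteq> {}"
  proof
    assume "R = {}"
    then have "a = 0\<^sub>m n n" using ac by (intro eq_matI) (auto simp: R_def)
    then show False using a by simp
  qed
  moreover have finR: "finite R" by (simp add: R_def)
  ultimately have "Max R \<in> R" by simp
  then obtain i s where i: "i = Max R" "i < n" "s < n" "a $$ (i, s) \<noteq> 0"
    by (auto simp: R_def)
  have "(u i * a) $$ (i, s) = (\<Sum>c<n. u i $$ (i, c) * a $$ (c, s))"
    using i uc ac by (simp add: mult_entry[of _ n])
  also have "\<dots> = (\<Sum>c\<in>{i}. u i $$ (i, c) * a $$ (c, s))"
  proof (rule sum.mono_neutral_right)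
    show "\<forall>c\<in>{..<n} - {i}. u i $$ (i, c) * a $$ (c, s) = 0"
    proof
      fix c assume c: "c \<in> {..<n} - {i}"
      show "u i $$ (i, c) * a $$ (c, s) = 0"
      proof (cases "c < i")
        case True
        then show ?thesis using u[OF i(2)] c i band_entry[of "u i" n 0 c i]
          by (simp add: primitive_at_def)
      next
        case False
        then have "c \<notin> R" using c i(1) Max_ge[OF finR, of c] by auto
        then show ?thesis using c i by (auto simp: R_def)
      qed
    qed
  qed (use i in auto)
  also have "\<dots> \<noteq> 0" using u[OF i(2)] i by (simp add: primitive_at_def)
  finally have "\<exists>s<n. (u i * a) $$ (i, s) \<noteq> 0" using i by blast
  define b where "b = u i * a"
  have bc: "b \<in> carrier_mat n n" using mult_carrier_mat[OF uc[OF i(2)] ac] by (simp add: b_def)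
  define P where "P = (\<lambda>s. s < n \<and> b $$ (i, s) \<noteq> 0)"
  have "\<exists>s. P s" using \<open>\<exists>s<n. (u i * a) $$ (i, s) \<noteq> 0\<close> by (auto simp: P_def b_def)
  then obtain j where j: "P j" "\<And>s. s < j \<Longrightarrow> \<not> P s"
    using LeastI_ex[of P] not_less_Least[of _ P] by metis
  have jn: "j < n" using j by (simp add: P_def)
  have "(b * u j) $$ (i, j) = (\<Sum>c<n. b $$ (i, c) * u j $$ (c, j))"
    using i uc jn bc by (simp add: mult_entry[of _ n])
  also have "\<dots> = (\<Sum>c\<in>{j}. b $$ (i, c) * u j $$ (c, j))"
  proof (rule sum.mono_neutral_right)
    show "\<forall>c\<in>{..<n} - {j}. b $$ (i, c) * u j $$ (c, j) = 0"
    proof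
      fix c assume c: "c \<in> {..<n} - {j}"
      show "b $$ (i, c) * u j $$ (c, j) = 0"
      proof (cases "c < j")
        case True
        then show ?thesis using j(2)[OF True] c by (simp add: P_def)
      next
        case False
        then show ?thesis using u[OF jn] c jn band_entry[of "u j" n 0 j c]
          by (simp add: primitive_at_def)
      qed
    qed
  qed (use jn in auto)
  also have "\<dots> \<noteq> 0" using u[OF jn] jn j by (simp add: primitive_at_def P_def)
  finally have "u i * a * u j \<noteq> 0\<^sub>m n n" using i jn by (auto simp: b_def)
  then show ?thesis using i jn by blast
qed

text \<open>
  An upper triangular matrix is annihilated by the product of \<open>x - x\<^sub>k\<^sub>k\<close> over all \<open>k\<close>, which here
  is \<open>x\<^bsup>n-1\<^esup> (x - 1)\<close>; so the powers of \<open>x\<close> are eventually constant, and the limit is idempotent.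
  The proof performs this multiplication one column at a time: each factor kills one more column.
\<close>

lemma power_primitive:
  assumes x: "x \<in> band n 0" and i: "i < n"
    and d: "\<And>a. a < n \<Longrightarrow> x $$ (a, a) = (if a = i then 1 else 0)"
  shows "primitive_at n i (x ^\<^sub>m n)"
proof -
  have xc: "x \<in> carrier_mat n n" using x by (rule band_carrier)
  have pc: "x ^\<^sub>m k \<in> carrier_mat n n" for k using xc by simp
  have pb: "x ^\<^sub>m k \<in> band n 0" for k
    by (induction k) (use x xc band_mult[of _ n 0 x 0] in auto)
  have pd: "(x ^\<^sub>m Suc k) $$ (a, a) = (if a = i then 1 else 0)" if "a < n" for k a
  proof (induction k)
    case 0
    then show ?case using that d xc by simp
  next
    case (Suc k)
    then show ?case
      using diag_mult[OF pb[of "Suc k"] x that] d[OF that] by auto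
  qed
  have step: "(M * x) $$ (a, b) = (if b < k then 0 else M $$ (a, k) * x $$ (k, k))"
    if M: "M \<in> carrier_mat n n" and z: "\<And>a b. a < n \<Longrightarrow> b < k \<Longrightarrow> M $$ (a, b) = 0"
      and "a < n" "b \<le> k" "k < n" for M a b k
  proof -
    have "(M * x) $$ (a, b) = (\<Sum>c<n. M $$ (a, c) * x $$ (c, b))"
      using that by (intro mult_entry[OF M xc]) auto
    also have "\<dots> = (\<Sum>c<n. if c = k \<and> b = k then M $$ (a, k) * x $$ (k, k) else 0)"
    proof (rule sum.cong)
      fix c assume "c \<in> {..<n}"
      then show "M $$ (a, c) * x $$ (c, b) = (if c = k \<and> b = k then M $$ (a, k) * x $$ (k, k) else 0)"
        using that band_entry[OF x, of b c] z[of a c] by (cases "c < k") (auto simp: not_less)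
    qed simp
    also have "\<dots> = (if b < k then 0 else M $$ (a, k) * x $$ (k, k))"
      using that by (cases "b = k") auto
    finally show ?thesis .
  qed
  \<comment> \<open>Factors for the rows before \<open>i\<close>, where the diagonal of \<open>x\<close> vanishes.\<close>
  have low: "(x ^\<^sub>m k) $$ (a, b) = 0" if "k \<le> i" "a < n" "b < k" for k a b
    using that
  proof (induction k arbitrary: a b)
    case (Suc k)
    then show ?case using step[of "x ^\<^sub>m k" k a b] pc d i by auto
  qed simp
  \<comment> \<open>The factor \<open>x - 1\<close> at row \<open>i\<close>, then the remaining factors \<open>x\<close>.\<close>
  have high: "(x ^\<^sub>m Suc (i + k)) $$ (a, b) = (x ^\<^sub>m (i + k)) $$ (a, b)"
    if "Suc (i + k) \<le> n" "a < n" "b < Suc (i + k)" for k a b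
    using that
  proof (induction k arbitrary: a b)
    case 0
    have l: "(x ^\<^sub>m i) $$ (r, s) = 0" if "r < n" "s < i" for r s
      using low[of i r s] that by simp
    show ?case
      using step[of "x ^\<^sub>m i" i a b] pc l 0 i d by (auto simp: less_Suc_eq)
  next
    case (Suc k)
    let ?c = "Suc (i + k)" and ?M = "x ^\<^sub>m Suc (i + k) - x ^\<^sub>m (i + k)"
    have M: "?M \<in> carrier_mat n n" using pc by (meson minus_carrier_mat)
    have "?M $$ (r, s) = 0" if "r < n" "s < ?c" for r s
      using Suc.IH[of r s] that Suc.prems diff_entry[OF pc[of "i + k"], of r s "x ^\<^sub>m ?c"]
      by (simp del: pow_mat.simps)
    then have "(?M * x) $$ (a, b) = 0"
      using step[OF M, of ?c a b] Suc.prems d by auto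
    moreover have "?M * x = x ^\<^sub>m Suc ?c - x ^\<^sub>m ?c"
      using minus_mult_distrib_mat[OF pc[of ?c] pc[of "i + k"] xc] by simp
    ultimately show ?case
      using diff_entry[OF pc[of ?c], of a b "x ^\<^sub>m Suc ?c"] Suc.prems
      by (simp del: pow_mat.simps)
  qed
  obtain k where k: "n = Suc (i + k)" using i less_imp_Suc_add by blast
  have stable: "x ^\<^sub>m Suc (i + k) = x ^\<^sub>m (i + k)"
    using high[of k] k by (intro square_mat_eqI[OF pc pc]) simp_all
  then have "x ^\<^sub>m n * x = x ^\<^sub>m n"
    unfolding k by (metis pow_mat.simps(2))
  then have "x ^\<^sub>m n * x ^\<^sub>m m = x ^\<^sub>m n" for m
    by (induction m) (use xc pc in \<open>simp_all flip: assoc_mult_mat[of _ n n _ n _ n]\<close>)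
  then have "x ^\<^sub>m n * x ^\<^sub>m n = x ^\<^sub>m n" .
  then show ?thesis
    using pb[of n] pd[of _ "i + k"] k by (simp add: primitive_at_def del: pow_mat.simps)
qed

section \<open>Homogeneous components\<close>

lemma finsum_entry:
  fixes x :: "'g \<Rightarrow> 'k::field mat"
  assumes "finite S" and "\<And>g. g \<in> S \<Longrightarrow> x g \<in> band n 0" and "a < n" "b < n"
  shows "finsum (UT_alg n) x S $$ (a, b) = (\<Sum>g\<in>S. x g $$ (a, b))"
proof -
  interpret R: ring "UT_alg n :: ('k, 'k mat) module" by (rule ring_UT_alg)
  have "finsum (UT_alg n) x S \<in> band n 0 \<and>
      finsum (UT_alg n) x S $$ (a, b) = (\<Sum>g\<in>S. x g $$ (a, b))"
    using assms(1,2)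
  proof (induction S)
    case empty
    then show ?case using assms(3,4) by (simp add: UT_alg_simps)
  next
    case (insert g S)
    have F: "x \<in> S \<rightarrow> carrier (UT_alg n)" "x g \<in> carrier (UT_alg n)"
      using insert.prems by (auto simp: carrier_UT_alg)
    have e: "finsum (UT_alg n) x (insert g S) = x g + finsum (UT_alg n) x S"
      using R.finsum_insert[OF insert.hyps F] by (simp add: UT_alg_simps)
    show ?case unfolding e
      using insert assms(3,4) by (auto simp: band_add dest: band_carrier)
  qed
  then show ?thesis by simp
qed

locale UT_grading = group G for G :: "('g, 'm) monoid_scheme" (structure) +
  fixes n :: nat and \<Gamma> :: "'g \<Rightarrow> 'k::field mat set"
  assumes grading: "alg_grading G (UT_alg n) \<Gamma>"
begin

abbreviation supp :: "('g \<Rightarrow> 'k mat) \<Rightarrow> 'g set" where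
  "supp x \<equiv> {g \<in> carrier G. x g \<noteq> 0\<^sub>m n n}"

definition component :: "'k mat \<Rightarrow> 'g \<Rightarrow> 'k mat" where
  "component a = (THE x. x \<in> (\<Pi>\<^sub>E g\<in>carrier G. \<Gamma> g) \<and>
     finite (supp x) \<and> a = finsum (UT_alg n) x (supp x))"

lemma
  assumes "g \<in> carrier G"
  shows piece_band: "a \<in> \<Gamma> g \<Longrightarrow> a \<in> band n 0"
    and piece_zero: "0\<^sub>m n n \<in> \<Gamma> g"
    and piece_add: "a \<in> \<Gamma> g \<Longrightarrow> b \<in> \<Gamma> g \<Longrightarrow> a + b \<in> \<Gamma> g"
    and piece_smult: "a \<in> \<Gamma> g \<Longrightarrow> c \<cdot>\<^sub>m a \<in> \<Gamma> g"
  using grading assms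
  by (auto simp: alg_grading_def alg_subspace_def UT_alg_simps(4-6) carrier_UT_alg)

lemma piece_mult:
  "g \<in> carrier G \<Longrightarrow> h \<in> carrier G \<Longrightarrow> a \<in> \<Gamma> g \<Longrightarrow> b \<in> \<Gamma> h \<Longrightarrow> a * b \<in> \<Gamma> (g \<otimes> h)"
  using grading by (auto simp: alg_grading_def UT_alg_simps(2))

lemma component_ex1:
  "a \<in> band n 0 \<Longrightarrow> \<exists>!x. x \<in> (\<Pi>\<^sub>E g\<in>carrier G. \<Gamma> g) \<and>
     finite (supp x) \<and> a = finsum (UT_alg n) x (supp x)"
  using grading by (simp add: alg_grading_def UT_alg_simps(4) carrier_UT_alg)

lemma
  assumes a: "a \<in> band n 0"
  shows component_in: "g \<in> carrier G \<Longrightarrow> component a g \<in> \<Gamma> g"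
    and component_finite: "finite (supp (component a))"
    and component_sum: "i < n \<Longrightarrow> j < n \<Longrightarrow> a $$ (i, j) = (\<Sum>g\<in>supp (component a). component a g $$ (i, j))"
proof -
  have *: "component a \<in> (\<Pi>\<^sub>E g\<in>carrier G. \<Gamma> g) \<and>
      finite (supp (component a)) \<and> a = finsum (UT_alg n) (component a) (supp (component a))"
    unfolding component_def by (rule theI'[OF component_ex1[OF a]])
  then show in': "component a g \<in> \<Gamma> g" if "g \<in> carrier G" for g using that by auto
  show "finite (supp (component a))" using * by simp
  show "a $$ (i, j) = (\<Sum>g\<in>supp (component a). component a g $$ (i, j))" if "i < n" "j < n"
    using * finsum_entry[of "supp (component a)" "component a" n i j] in' piece_band that by auto
qed

text \<open>
  Stating uniqueness entrywise, over any finite index set containing the support, reduces the rules for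
  components of sums, multiples and products to manipulations of finite sums in the field.
\<close>

lemma component_unique:
  assumes a: "a \<in> band n 0" and y: "\<And>g. g \<in> carrier G \<Longrightarrow> y g \<in> \<Gamma> g"
    and S: "finite S" "S \<subseteq> carrier G" "\<And>g. g \<in> carrier G \<Longrightarrow> g \<notin> S \<Longrightarrow> y g = 0\<^sub>m n n"
    and sum: "\<And>i j. i < n \<Longrightarrow> j < n \<Longrightarrow> a $$ (i, j) = (\<Sum>g\<in>S. y g $$ (i, j))"
    and g: "g \<in> carrier G"
  shows "component a g = y g"
proof -
  interpret R: ring "UT_alg n :: ('k, 'k mat) module" by (rule ring_UT_alg)
  define z where "z = restrict y (carrier G)"
  have supp: "supp z \<subseteq> S" using S by (auto simp: z_def)
  then have fin: "finite (supp z)" using S finite_subset by blast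
  have zb: "z g \<in> band n 0" if "g \<in> carrier G" for g using that y piece_band by (simp add: z_def)
  have F: "finsum (UT_alg n) z (supp z) \<in> carrier (UT_alg n)"
    using zb by (intro R.finsum_closed) (auto simp: carrier_UT_alg)
  have "a = finsum (UT_alg n) z (supp z)"
  proof (rule eq_matI)
    fix i j
    assume "i < dim_row (finsum (UT_alg n) z (supp z))" "j < dim_col (finsum (UT_alg n) z (supp z))"
    then have ij: "i < n" "j < n"
      using F by (auto simp: carrier_UT_alg dest: band_carrier)
    have "a $$ (i, j) = (\<Sum>g\<in>S. z g $$ (i, j))"
      unfolding sum[OF ij] using S by (intro sum.cong) (auto simp: z_def)
    also have "\<dots> = (\<Sum>g\<in>supp z. z g $$ (i, j))"
      using supp S ij by (intro sum.mono_neutral_right) auto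
    also have "\<dots> = finsum (UT_alg n) z (supp z) $$ (i, j)"
      using finsum_entry[OF fin, of z n i j] zb ij by simp
    finally show "a $$ (i, j) = finsum (UT_alg n) z (supp z) $$ (i, j)" .
  qed (use F a in \<open>auto simp: carrier_UT_alg dest!: band_carrier\<close>)
  moreover have "z \<in> (\<Pi>\<^sub>E g\<in>carrier G. \<Gamma> g)" using y by (auto simp: z_def)
  ultimately have "component a = z"
    unfolding component_def using fin by (intro the1_equality[OF component_ex1[OF a]]) auto
  then show ?thesis using g by (simp add: z_def)
qed

lemma component_add:
  assumes a: "a \<in> band n 0" and b: "b \<in> band n 0" and g: "g \<in> carrier G"
  shows "component (a + b) g = component a g + component b g"
proof (rule component_unique[where S = "supp (component a) \<union> supp (component b)"])
  let ?A = "supp (component a)" and ?B = "supp (component b)"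
  fix i j assume ij: "i < n" "j < n"
  have cc: "component c h \<in> carrier_mat n n" if "h \<in> carrier G" "c \<in> band n 0" for c h
    using that component_in piece_band band_carrier by meson
  have ext: "c $$ (i, j) = (\<Sum>h\<in>?A \<union> ?B. component c h $$ (i, j))"
    if c: "c \<in> band n 0" and sub: "supp (component c) \<subseteq> ?A \<union> ?B" for c
    unfolding component_sum[OF c ij] using sub component_finite a b ij
    by (intro sum.mono_neutral_left) auto
  have "(a + b) $$ (i, j) = a $$ (i, j) + b $$ (i, j)"
    using a b ij by (auto dest!: band_carrier)
  also have "\<dots> = (\<Sum>h\<in>?A \<union> ?B. component a h $$ (i, j) + component b h $$ (i, j))"
    using ext[OF a] ext[OF b] by (simp add: sum.distrib)
  also have "\<dots> = (\<Sum>h\<in>?A \<union> ?B. (component a h + component b h) $$ (i, j))"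
    using ij cc[OF _ b] by (intro sum.cong) (auto simp: carrier_matD[OF cc[OF _ b]])
  finally show "(a + b) $$ (i, j) = \<dots>" .
qed (use a b g band_add component_in component_finite piece_add in auto)

lemma component_smult:
  assumes a: "a \<in> band n 0" and g: "g \<in> carrier G"
  shows "component (c \<cdot>\<^sub>m a) g = c \<cdot>\<^sub>m component a g"
proof (rule component_unique[where S = "supp (component a)"])
  fix i j assume ij: "i < n" "j < n"
  have cc: "component a h \<in> carrier_mat n n" if "h \<in> carrier G" for h
    using that a component_in piece_band band_carrier by meson
  then show "(c \<cdot>\<^sub>m a) $$ (i, j) = (\<Sum>h\<in>supp (component a). (c \<cdot>\<^sub>m component a h) $$ (i, j))"
    using component_sum[OF a ij] ij band_carrier[OF a]
    by (auto simp: sum_distrib_left cc carrier_matD[OF cc] intro!: sum.cong)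
qed (use a g band_smult component_in component_finite piece_smult in auto)

lemma component_homogeneous:
  assumes a: "a \<in> \<Gamma> h" and h: "h \<in> carrier G" and g: "g \<in> carrier G"
  shows "component a g = (if g = h then a else 0\<^sub>m n n)"
  by (rule component_unique[where S = "{h}"]) (use a g h piece_zero piece_band in auto)

lemma piece_disjoint:
  assumes "a \<in> \<Gamma> g" "a \<in> \<Gamma> h" "g \<in> carrier G" "h \<in> carrier G" "a \<noteq> 0\<^sub>m n n"
  shows "g = h"
  using component_homogeneous[of a g g] component_homogeneous[of a h g] assms
  by (auto split: if_splits)

lemma component_mult_left:
  assumes x: "x \<in> \<Gamma> g" "g \<in> carrier G" and a: "a \<in> band n 0" and h: "h \<in> carrier G"
  shows "component (x * a) (g \<otimes> h) = x * component a h"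
proof -
  have xb: "x \<in> band n 0" using x piece_band by simp
  have cc: "component a h \<in> carrier_mat n n" if "h \<in> carrier G" for h
    using that a component_in piece_band band_carrier by meson
  have "component (x * a) (g \<otimes> h) = x * component a (inv g \<otimes> (g \<otimes> h))"
  proof (rule component_unique[where S = "(\<lambda>h. g \<otimes> h) ` supp (component a)"
        and y = "\<lambda>k. x * component a (inv g \<otimes> k)"])
    show "x * a \<in> band n 0" using band_mult[OF xb a] by simp
    show "x * component a (inv g \<otimes> k) \<in> \<Gamma> k" if "k \<in> carrier G" for k
      using piece_mult[of g "inv g \<otimes> k" x "component a (inv g \<otimes> k)"] x that a component_in
      by (simp flip: m_assoc)
    show "x * component a (inv g \<otimes> k) = 0\<^sub>m n n"
      if "k \<in> carrier G" "k \<notin> (\<lambda>h. g \<otimes> h) ` supp (component a)" for k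
    proof -
      have "k = g \<otimes> (inv g \<otimes> k)" using that x by (simp flip: m_assoc)
      then have "inv g \<otimes> k \<notin> supp (component a)" using that by blast
      then have "component a (inv g \<otimes> k) = 0\<^sub>m n n" using that x by simp
      then show ?thesis using band_carrier[OF xb] by simp
    qed
    fix i j assume ij: "i < n" "j < n"
    have "(x * a) $$ (i, j) = (\<Sum>c<n. x $$ (i, c) * a $$ (c, j))"
      using xb a ij by (simp add: mult_entry[of _ n] band_carrier)
    also have "\<dots> = (\<Sum>c<n. \<Sum>h\<in>supp (component a). x $$ (i, c) * component a h $$ (c, j))"
      using component_sum[OF a _ ij(2)] by (simp add: sum_distrib_left)
    also have "\<dots> = (\<Sum>h\<in>supp (component a). \<Sum>c<n. x $$ (i, c) * component a h $$ (c, j))"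
      by (rule sum.swap)
    also have "\<dots> = (\<Sum>h\<in>supp (component a). (x * component a h) $$ (i, j))"
      using ij xb cc by (intro sum.cong) (auto simp: mult_entry[of _ n] band_carrier)
    also have "\<dots> = (\<Sum>k\<in>(\<lambda>h. g \<otimes> h) ` supp (component a).
        (x * component a (inv g \<otimes> k)) $$ (i, j))"
    proof (subst sum.reindex)
      have "inv g \<otimes> (g \<otimes> h) = h" if "h \<in> carrier G" for h
        using that x by (simp flip: m_assoc)
      then show "(\<Sum>h\<in>supp (component a). (x * component a h) $$ (i, j))
          = sum ((\<lambda>k. (x * component a (inv g \<otimes> k)) $$ (i, j)) \<circ> (\<lambda>h. g \<otimes> h)) (supp (component a))"
        by simp
    qed (use x in \<open>simp add: inj_on_def\<close>)
    finally show "(x * a) $$ (i, j) = \<dots>" .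
  qed (use x h a component_finite in auto)
  then show ?thesis using x h by (simp flip: m_assoc)
qed

lemma component_mult_right:
  assumes x: "x \<in> \<Gamma> g" "g \<in> carrier G" and a: "a \<in> band n 0" and h: "h \<in> carrier G"
  shows "component (a * x) (h \<otimes> g) = component a h * x"
proof -
  have xb: "x \<in> band n 0" using x piece_band by simp
  have cc: "component a h \<in> carrier_mat n n" if "h \<in> carrier G" for h
    using that a component_in piece_band band_carrier by meson
  have "component (a * x) (h \<otimes> g) = component a (h \<otimes> g \<otimes> inv g) * x"
  proof (rule component_unique[where S = "(\<lambda>h. h \<otimes> g) ` supp (component a)"
        and y = "\<lambda>k. component a (k \<otimes> inv g) * x"])
    show "a * x \<in> band n 0" using band_mult[OF a xb] by simp
    show "component a (k \<otimes> inv g) * x \<in> \<Gamma> k" if "k \<in> carrier G" for k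
      using piece_mult[of "k \<otimes> inv g" g "component a (k \<otimes> inv g)" x] x that a component_in
      by (simp add: m_assoc)
    show "component a (k \<otimes> inv g) * x = 0\<^sub>m n n"
      if "k \<in> carrier G" "k \<notin> (\<lambda>h. h \<otimes> g) ` supp (component a)" for k
    proof -
      have "k = k \<otimes> inv g \<otimes> g" using that x by (simp add: m_assoc)
      then have "k \<otimes> inv g \<notin> supp (component a)" using that by blast
      then have "component a (k \<otimes> inv g) = 0\<^sub>m n n" using that x by simp
      then show ?thesis using band_carrier[OF xb] by simp
    qed
    fix i j assume ij: "i < n" "j < n"
    have "(a * x) $$ (i, j) = (\<Sum>c<n. a $$ (i, c) * x $$ (c, j))"
      using xb a ij by (simp add: mult_entry[of _ n] band_carrier)
    also have "\<dots> = (\<Sum>c<n. \<Sum>h\<in>supp (component a). component a h $$ (i, c) * x $$ (c, j))"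
      using component_sum[OF a ij(1)] by (simp add: sum_distrib_right)
    also have "\<dots> = (\<Sum>h\<in>supp (component a). \<Sum>c<n. component a h $$ (i, c) * x $$ (c, j))"
      by (rule sum.swap)
    also have "\<dots> = (\<Sum>h\<in>supp (component a). (component a h * x) $$ (i, j))"
      using ij xb cc by (intro sum.cong) (auto simp: mult_entry[of _ n] band_carrier)
    also have "\<dots> = (\<Sum>k\<in>(\<lambda>h. h \<otimes> g) ` supp (component a).
        (component a (k \<otimes> inv g) * x) $$ (i, j))"
    proof (subst sum.reindex)
      have "h \<otimes> g \<otimes> inv g = h" if "h \<in> carrier G" for h
        using that x by (simp add: m_assoc)
      then show "(\<Sum>h\<in>supp (component a). (component a h * x) $$ (i, j))
          = sum ((\<lambda>k. (component a (k \<otimes> inv g) * x) $$ (i, j)) \<circ> (\<lambda>h. h \<otimes> g)) (supp (component a))"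
        by simp
    qed (use x in \<open>simp add: inj_on_def\<close>)
    finally show "(a * x) $$ (i, j) = \<dots>" .
  qed (use x h a component_finite in auto)
  then show ?thesis using x h by (simp add: m_assoc)
qed

lemma component_nonzero:
  assumes "a \<in> band n 0" "i < n" "j < n" "a $$ (i, j) \<noteq> 0"
  obtains g where "g \<in> carrier G" "component a g \<in> \<Gamma> g" "component a g $$ (i, j) \<noteq> 0"
proof -
  have "(\<Sum>g\<in>supp (component a). component a g $$ (i, j)) \<noteq> 0"
    using component_sum[OF assms(1-3)] assms(4) by simp
  then obtain g where "g \<in> supp (component a)" "component a g $$ (i, j) \<noteq> 0"
    by (rule sum.not_neutral_contains_not_neutral)
  then show ?thesis using that[of g] component_in[OF assms(1)] by simp
qed

section \<open>The diagonal of a homogeneous matrix\<close>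

text \<open>
  Let \<open>N\<close> be a multiple of \<open>e\<^sub>k\<^sub>l\<close> up to terms further from the diagonal, for which the claim is
  assumption \<open>IH\<close>, and put \<open>c h = \<chi>\<^sub>i (N\<^sub>h)\<close>. Then \<open>x N\<close> and \<open>N x\<close> agree with
  \<open>x\<^sub>k\<^sub>k N\<close> and \<open>x\<^sub>l\<^sub>l N\<close> up to such terms. Reading off components turns this into
  \<open>\<chi>\<^sub>i x \<cdot> c h = x\<^sub>k\<^sub>k \<cdot> c (g h)\<close> and \<open>c h \<cdot> \<chi>\<^sub>i x = x\<^sub>l\<^sub>l \<cdot> c (h g)\<close> for \<open>x\<close> of
  degree \<open>g\<close>. If \<open>c\<close> is not identically zero, the two relations force \<open>x\<^sub>k\<^sub>k = x\<^sub>l\<^sub>l\<close> for all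
  homogeneous \<open>x\<close>, hence for all \<open>x\<close>, and \<open>e\<^sub>k\<^sub>k\<close> is a counterexample.
\<close>

lemma components_diag_zero_step:
  assumes i: "i < n" and l: "l = k + m" "k < l" "l < n"
    and N: "N \<in> band n m" "\<And>a. a + m < n \<Longrightarrow> a \<noteq> k \<Longrightarrow> N $$ (a, a + m) = 0"
    and IH: "\<And>D g. D \<in> band n (Suc m) \<Longrightarrow> g \<in> carrier G \<Longrightarrow> component D g $$ (i, i) = 0"
    and g0: "g0 \<in> carrier G"
  shows "component N g0 $$ (i, i) = 0"
proof (rule ccontr)
  assume nz: "component N g0 $$ (i, i) \<noteq> 0"
  define c where "c h = component N h $$ (i, i)" for h
  have N0: "N \<in> band n 0" using N(1) band_mono by blast
  have cb: "component a h \<in> band n 0" if "h \<in> carrier G" "a \<in> band n 0" for a h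
    using that component_in piece_band by meson
  have shift: "component P g $$ (i, i) = r * c g"
    if P: "P \<in> band n m" and g: "g \<in> carrier G"
      and edge: "\<And>a. a + m < n \<Longrightarrow> P $$ (a, a + m) = r * N $$ (a, a + m)" for P g r
  proof -
    let ?D = "P + (- r) \<cdot>\<^sub>m N"
    have "?D \<in> band n (Suc m)"
    proof (rule band_SucI)
      show "?D \<in> band n m" using P N(1) by (intro band_add band_smult)
      show "?D $$ (a, a + m) = 0" if "a + m < n" for a
        using that edge band_carrier[OF N(1)] by auto
    qed
    then have "component ?D g $$ (i, i) = 0" using IH g by blast
    moreover have "component ?D g = component P g + (- r) \<cdot>\<^sub>m component N g"
      using P N0 g band_mono[OF P, of 0] by (simp add: component_add component_smult band_smult)
    ultimately show ?thesis
      using i carrier_matD[OF band_carrier[OF cb[OF g N0]]] by (simp add: c_def)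
  qed
  have left: "x $$ (i, i) * c h = x $$ (k, k) * c (g \<otimes> h)"
    if x: "x \<in> \<Gamma> g" and g: "g \<in> carrier G" and h: "h \<in> carrier G" for x g h
  proof -
    have xb: "x \<in> band n 0" using x g piece_band by simp
    have "component (x * N) (g \<otimes> h) $$ (i, i) = x $$ (k, k) * c (g \<otimes> h)"
    proof (rule shift)
      show "x * N \<in> band n m" using band_mult[OF xb N(1)] by simp
      show "(x * N) $$ (a, a + m) = x $$ (k, k) * N $$ (a, a + m)" if "a + m < n" for a
        using band_mult_edge[OF xb N(1), of "a + m" a] N(2)[of a] that by (cases "a = k") auto
    qed (use g h in simp)
    then show ?thesis
      using component_mult_left[OF x g N0 h] diag_mult[OF xb cb[OF h N0] i] by (simp add: c_def)
  qed
  have right: "c h * x $$ (i, i) = x $$ (l, l) * c (h \<otimes> g)"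
    if x: "x \<in> \<Gamma> g" and g: "g \<in> carrier G" and h: "h \<in> carrier G" for x g h
  proof -
    have xb: "x \<in> band n 0" using x g piece_band by simp
    have "component (N * x) (h \<otimes> g) $$ (i, i) = x $$ (l, l) * c (h \<otimes> g)"
    proof (rule shift)
      show "N * x \<in> band n m" using band_mult[OF N(1) xb] by simp
      show "(N * x) $$ (a, a + m) = x $$ (l, l) * N $$ (a, a + m)" if "a + m < n" for a
        using band_mult_edge[OF N(1) xb, of "a + m" a] N(2)[of a] that l by (cases "a = k") auto
    qed (use g h in simp)
    then show ?thesis
      using component_mult_right[OF x g N0 h] diag_mult[OF cb[OF h N0] xb i] by (simp add: c_def)
  qed
  \<comment> \<open>The support of \<open>c\<close> is finite and, by \<open>left\<close> applied to the components of \<open>N\<close>, stable under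
    translation by one of its own elements; such a translation is a permutation of the support,
    so the support contains the unit.\<close>
  have c1: "c \<one> \<noteq> 0"
  proof -
    define T where "T = {h \<in> carrier G. c h \<noteq> 0}"
    have "T \<subseteq> supp (component N)" using i by (auto simp: T_def c_def)
    then have fin: "finite T" using component_finite[OF N0] finite_subset by blast
    have g0T: "g0 \<in> T" using g0 nz by (simp add: T_def c_def)
    have closed: "g0 \<otimes> h \<in> T" if "h \<in> T" for h
      using left[OF component_in[OF N0 g0] g0, of h] that g0 nz by (auto simp: T_def c_def)
    have "(\<lambda>h. g0 \<otimes> h) ` T = T"
      using closed g0 by (intro endo_inj_surj[OF fin]) (auto simp: inj_on_def T_def)
    then obtain t where "t \<in> T" "g0 \<otimes> t = g0" using g0T by (metis imageE)
    then show ?thesis using g0 r_cancel_one'[of t g0] by (auto simp: T_def)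
  qed
  have agree: "x $$ (k, k) = x $$ (l, l)" if x: "x \<in> \<Gamma> g" and g: "g \<in> carrier G" for x g
    \<comment> \<open>If \<open>c g\<close> vanishes, both entries are zero: take \<open>h\<close> inverse to \<open>g\<close>. Otherwise take \<open>h = 1\<close>.\<close>
  proof (cases "c g = 0")
    case True
    then have "x $$ (i, i) = 0" using left[OF x g one_closed] c1 g by simp
    then show ?thesis
      using left[OF x g inv_closed[OF g]] right[OF x g inv_closed[OF g]] c1 g by simp
  next
    case False
    then show ?thesis using left[OF x g one_closed] right[OF x g one_closed] g
      by (simp add: mult.commute)
  qed
  let ?e = "matrix_unit n k k :: 'k mat"
  have e: "?e \<in> band n 0" by (simp add: matrix_unit_band)
  have "?e $$ (k, k) = ?e $$ (l, l)"
    unfolding component_sum[OF e order.strict_trans[OF l(2,3)] order.strict_trans[OF l(2,3)]]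
      component_sum[OF e l(3) l(3)]
    using agree component_in[OF e] by (intro sum.cong) auto
  then show False using l by (simp add: matrix_unit_entry)
qed

text \<open>
  Descending induction on the superdiagonal \<open>m\<close>; within one superdiagonal, the entries are split off
  one by one, and the \<open>t\<close> below counts how many of them may be nonzero.
\<close>

lemma components_diag_zero:
  assumes i: "i < n" and M: "M \<in> band n 1" and g: "g \<in> carrier G"
  shows "component M g $$ (i, i) = 0"
proof -
  have "1 \<le> n" using i by simp
  then have "\<forall>M\<in>band n 1. \<forall>g\<in>carrier G. component M g $$ (i, i) = 0"
  proof (induction rule: inc_induct)
    case base
    have "component (0\<^sub>m n n) g = 0\<^sub>m n n" if "g \<in> carrier G" for g
      using component_homogeneous[of "0\<^sub>m n n" g g] piece_zero that by simp
    then show ?case using i by (auto dest!: band_size)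
  next
    case (step m)
    have "component M g $$ (i, i) = 0"
      if "M \<in> band n m" "\<And>a. t \<le> a \<Longrightarrow> a + m < n \<Longrightarrow> M $$ (a, a + m) = 0" "g \<in> carrier G" for t M g
      using that
    proof (induction t arbitrary: M)
      case 0
      then show ?case using step.IH band_SucI by blast
    next
      case (Suc t)
      show ?case
      proof (cases "t + m < n")
        case False
        then show ?thesis using Suc by (metis add.commute add_le_mono1 le_less_trans leI not_less_eq_eq)
      next
        case True
        define N where "N = M $$ (t, t + m) \<cdot>\<^sub>m (matrix_unit n t (t + m) :: 'k mat)"
        have N: "N \<in> band n m" by (simp add: N_def band_smult matrix_unit_band)
        have Nc: "N \<in> carrier_mat n n" and Mc: "M \<in> carrier_mat n n"
          using N Suc.prems by (auto intro: band_carrier)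
        have Ne: "N $$ (a, a + m) = (if a = t then M $$ (t, t + m) else 0)" if "a + m < n" for a
          using that by (simp add: N_def matrix_unit_entry carrier_matD[OF matrix_unit_carrier])
        have d: "component N g $$ (i, i) = 0"
        proof (rule components_diag_zero_step[OF i refl])
          show "component D h $$ (i, i) = 0" if "D \<in> band n (Suc m)" "h \<in> carrier G" for D h
            using step.IH that by blast
        qed (use N Ne True step.hyps Suc.prems in auto)
        have MN: "component (M - N) g $$ (i, i) = 0"
        proof (rule Suc.IH)
          show "M - N \<in> band n m" using Suc.prems(1) N by (rule band_diff)
          show "(M - N) $$ (a, a + m) = 0" if "t \<le> a" "a + m < n" for a
            using Suc.prems(2)[of a] that Ne[of a] diff_entry[OF Nc, of a "a + m" M]
            by (cases "a = t") auto
        qed (use Suc.prems in auto)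
        have "M = (M - N) + N" using Mc Nc by (intro eq_matI) auto
        then have "component M g = component (M - N) g + component N g"
          using component_add[of "M - N" N g] band_mono[OF N, of 0]
            band_mono[OF band_diff[OF Suc.prems(1) N], of 0] Suc.prems(3) by simp
        moreover have "component N g \<in> carrier_mat n n"
          using component_in[of N g] band_mono[OF N, of 0] piece_band Suc.prems(3) band_carrier by blast
        ultimately show ?thesis using d MN i by simp
      qed
    qed
    from this[where t = n] show ?case by simp
  qed
  then show ?thesis using M g by blast
qed

lemma component_strictly_upper:
  assumes "M \<in> band n 1" and "g \<in> carrier G"
  shows "component M g \<in> band n 1"
proof -
  have "M \<in> band n 0" using assms(1) by (rule band_mono) simp
  then have "component M g \<in> band n 0" using assms component_in piece_band by blast
  then show ?thesis using components_diag_zero assms by (simp add: band_SucI)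
qed

text \<open>
  Multiplying components of consecutive superdiagonal matrix units keeps track of a nonzero entry. The
  factors stay strictly upper triangular because the radical is graded.
\<close>

lemma homogeneous_on_superdiagonal:
  "a + m < n \<Longrightarrow> \<exists>g\<in>carrier G. \<exists>L\<in>\<Gamma> g. L \<in> band n m \<and> L $$ (a, a + m) \<noteq> 0"
proof (induction m)
  case 0
  let ?e = "matrix_unit n a a :: 'k mat"
  have "?e \<in> band n 0" "?e $$ (a, a) \<noteq> 0"
    using 0 by (simp_all add: matrix_unit_band matrix_unit_entry)
  then obtain g where "g \<in> carrier G" "component ?e g \<in> \<Gamma> g" "component ?e g $$ (a, a) \<noteq> 0"
    using component_nonzero[of ?e a a] 0 by auto
  then show ?case using piece_band by auto
next
  case (Suc m)
  then obtain h L where L: "h \<in> carrier G" "L \<in> \<Gamma> h" "L \<in> band n m" "L $$ (a, a + m) \<noteq> 0"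
    by auto
  let ?e = "matrix_unit n (a + m) (a + Suc m) :: 'k mat"
  have e: "?e \<in> band n 1" "?e $$ (a + m, a + Suc m) \<noteq> 0"
    using Suc.prems by (simp_all add: matrix_unit_band matrix_unit_entry)
  then obtain g where g: "g \<in> carrier G" "component ?e g \<in> \<Gamma> g"
      "component ?e g $$ (a + m, a + Suc m) \<noteq> 0"
    using component_nonzero[of ?e "a + m" "a + Suc m"] band_mono[OF e(1), of 0] Suc.prems by auto
  have z: "component ?e g \<in> band n 1" using component_strictly_upper[OF e(1) g(1)] .
  have "(L * component ?e g) $$ (a, a + Suc m) \<noteq> 0"
    using band_mult_edge[OF L(3) z, of "a + Suc m" a] Suc.prems L g by simp
  moreover have "L * component ?e g \<in> band n (Suc m)" using band_mult[OF L(3) z] by simp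
  moreover have "L * component ?e g \<in> \<Gamma> (h \<otimes> g)" using piece_mult L g by blast
  ultimately show ?case using L g by blast
qed

text \<open>
  Inserting \<open>x\<close> between \<open>L\<close> and \<open>R\<close> changes the homogeneous element \<open>L R\<close> by a nonzero scalar only,
  so \<open>x\<close> does not contribute to the degree.
\<close>

lemma diag_nonzero_imp_degree_one:
  assumes x: "x \<in> \<Gamma> g" and g: "g \<in> carrier G" and i: "i < n" and nz: "x $$ (i, i) \<noteq> 0"
  shows "g = \<one>"
proof -
  have xb: "x \<in> band n 0" using x g piece_band by simp
  obtain h L where L: "h \<in> carrier G" "L \<in> \<Gamma> h" "L \<in> band n i" "L $$ (0, i) \<noteq> 0"
    using homogeneous_on_superdiagonal[of 0 i] i by auto
  obtain k R where R: "k \<in> carrier G" "R \<in> \<Gamma> k" "R \<in> band n (n - 1 - i)" "R $$ (i, n - 1) \<noteq> 0"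
    using homogeneous_on_superdiagonal[of i "n - 1 - i"] i by auto
  have eq: "L * x * R = x $$ (i, i) \<cdot>\<^sub>m (L * R)"
    and e: "(L * R) $$ (0, n - 1) \<noteq> 0"
    using top_band_sandwich[OF L(3) R(3) xb i] L R by simp_all
  have LR: "L * R \<in> \<Gamma> (h \<otimes> k)" using piece_mult L R by blast
  have "L * R \<in> carrier_mat n n"
    using band_carrier[OF L(3)] band_carrier[OF R(3)] by simp
  then have ne: "(L * x * R) $$ (0, n - 1) \<noteq> 0"
    unfolding eq using e nz i by (simp add: smult_entry[of _ n])
  have "L * x * R \<noteq> 0\<^sub>m n n"
  proof
    assume "L * x * R = 0\<^sub>m n n"
    then show False using ne i by simp
  qed
  moreover have "L * x * R \<in> \<Gamma> (h \<otimes> k)" unfolding eq using piece_smult LR L R by blast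
  moreover have "L * x * R \<in> \<Gamma> (h \<otimes> g \<otimes> k)" using piece_mult L R x g by blast
  ultimately have "h \<otimes> k = h \<otimes> g \<otimes> k" using piece_disjoint L R g by blast
  then have "h = h \<otimes> g" using L R g by simp
  then have "h \<otimes> g = h \<otimes> \<one>" using L by simp
  then show ?thesis using L g l_cancel by blast
qed

text \<open>
  Only the degree-one component of \<open>e\<^sub>i\<^sub>i\<close> contributes to its diagonal, and raising that component to
  the \<open>n\<close>-th power makes it idempotent.
\<close>

lemma homogeneous_primitive:
  assumes i: "i < n"
  shows "\<exists>u\<in>\<Gamma> \<one>. primitive_at n i u"
proof -
  let ?e = "matrix_unit n i i :: 'k mat"
  have e: "?e \<in> band n 0" by (simp add: matrix_unit_band)
  define v where "v = component ?e \<one>"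
  have v: "v \<in> \<Gamma> \<one>" using component_in[OF e] by (simp add: v_def)
  have diag: "v $$ (a, a) = (if a = i then 1 else 0)" if a: "a < n" for a
  proof -
    let ?S = "supp (component ?e)"
    have "?e $$ (a, a) = (\<Sum>g\<in>?S. component ?e g $$ (a, a))"
      using component_sum[OF e a a] .
    also have "\<dots> = (\<Sum>g\<in>?S. if g = \<one> then v $$ (a, a) else 0)"
      using diag_nonzero_imp_degree_one component_in[OF e] a
      by (intro sum.cong) (auto simp: v_def)
    also have "\<dots> = v $$ (a, a)"
      using component_finite[OF e] a by (auto simp: sum.delta v_def)
    finally show ?thesis using a by (simp add: matrix_unit_entry)
  qed
  have "v ^\<^sub>m Suc k \<in> \<Gamma> \<one>" for k
  proof (induction k)
    case 0
    then show ?case using v band_carrier[OF piece_band[OF one_closed v]] by simp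
  next
    case (Suc k)
    then show ?case using piece_mult[OF one_closed one_closed Suc v] by simp
  qed
  moreover obtain k where "n = Suc k" using i by (cases n) auto
  ultimately show ?thesis
    using power_primitive[OF piece_band[OF one_closed v] i diag] by metis
qed

end

section \<open>Automorphisms\<close>

lemma alg_autoD:
  fixes f :: "'k::field mat \<Rightarrow> 'k mat"
  assumes f: "f \<in> alg_auto (UT_alg n)"
  shows "x \<in> band n 0 \<Longrightarrow> f x \<in> band n 0"
    and "x \<in> band n 0 \<Longrightarrow> y \<in> band n 0 \<Longrightarrow> f (x * y) = f x * f y"
    and "x \<in> band n 0 \<Longrightarrow> f (c \<cdot>\<^sub>m x) = c \<cdot>\<^sub>m f x"
    and "f (0\<^sub>m n n) = 0\<^sub>m n n"
    and "x \<in> band n 0 \<Longrightarrow> f x = 0\<^sub>m n n \<Longrightarrow> x = 0\<^sub>m n n"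
proof -
  have f': "f \<in> Ring.ring_hom (UT_alg n) (UT_alg n)" "bij_betw f (band n 0) (band n 0)"
    and sm: "\<And>c x. x \<in> band n 0 \<Longrightarrow> f (c \<cdot>\<^sub>m x) = c \<cdot>\<^sub>m f x"
    using f by (auto simp: alg_auto_def Bij_def carrier_UT_alg UT_alg_simps(6))
  show cl: "f x \<in> band n 0" if "x \<in> band n 0" for x
    using f' that by (auto simp: bij_betw_def)
  show "f (x * y) = f x * f y" if "x \<in> band n 0" "y \<in> band n 0"
    using ring_hom_mult[OF f'(1)] that by (simp add: carrier_UT_alg UT_alg_simps(2))
  show "f (c \<cdot>\<^sub>m x) = c \<cdot>\<^sub>m f x" if "x \<in> band n 0" using sm that .
  have z: "(0 :: 'k) \<cdot>\<^sub>m x = 0\<^sub>m n n" if "x \<in> band n 0" for x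
    using band_carrier[OF that] by (intro eq_matI) auto
  show f0: "f (0\<^sub>m n n) = 0\<^sub>m n n"
    using sm[of "0\<^sub>m n n" 0] z cl[of "0\<^sub>m n n"] by simp
  show "x = 0\<^sub>m n n" if "x \<in> band n 0" "f x = 0\<^sub>m n n"
    using that f0 f'(2) by (auto simp: bij_betw_def dest!: inj_onD[of f _ x "0\<^sub>m n n"])
qed

text \<open>
  Superdiagonal matrix units square to zero, so their images have zero diagonal. Every other
  \<open>e\<^sub>a\<^sub>b\<close> with \<open>a < b\<close> is a product of \<open>b - a\<close> matrix units on the first superdiagonal.
\<close>

lemma alg_auto_superdiagonal:
  fixes f :: "'k::field mat \<Rightarrow> 'k mat"
  assumes f: "f \<in> alg_auto (UT_alg n)"
  shows "a + m < n \<Longrightarrow> f (matrix_unit n a (a + m)) \<in> band n m"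
proof (induction m)
  case 0
  then show ?case using alg_autoD(1)[OF f] by (simp add: matrix_unit_band)
next
  case (Suc m)
  note b = matrix_unit_band[where m = 0, simplified]
  let ?e = "matrix_unit n (a + m) (a + Suc m) :: 'k mat"
  have e: "?e \<in> band n 0" by (simp add: b)
  have fe: "f ?e \<in> band n 0" using alg_autoD(1)[OF f e] .
  have "f ?e * f ?e = f (?e * ?e)" using alg_autoD(2)[OF f e e] by (rule sym)
  also have "?e * ?e = 0\<^sub>m n n"
    using Suc.prems by (subst matrix_unit_mult) auto
  also have "f (0\<^sub>m n n) = 0\<^sub>m n n" by (rule alg_autoD(4)[OF f])
  finally have "f ?e * f ?e = 0\<^sub>m n n" .
  then have "f ?e $$ (r, r) * f ?e $$ (r, r) = 0" if "r < n" for r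
    using diag_mult[OF fe fe that] that by simp
  then have "f ?e \<in> band n (Suc 0)" using fe by (intro band_SucI) auto
  moreover have "f (matrix_unit n a (a + m)) \<in> band n m" using Suc by simp
  moreover have "matrix_unit n a (a + Suc m) = matrix_unit n a (a + m) * ?e"
    using Suc.prems by (subst matrix_unit_mult) auto
  then have "f (matrix_unit n a (a + Suc m)) = f (matrix_unit n a (a + m)) * f ?e"
    using alg_autoD(2)[OF f, of "matrix_unit n a (a + m)" ?e] by (simp add: b)
  ultimately show ?case using band_mult[of _ n m "f ?e" 1] by simp
qed

text \<open>
  Apply \<open>f\<close> to \<open>e\<^sub>0\<^sub>i x e\<^sub>i\<^sub>,\<^sub>n\<^sub>-\<^sub>1 = x\<^sub>i\<^sub>i e\<^sub>0\<^sub>,\<^sub>n\<^sub>-\<^sub>1\<close>: the images of the outer factors lie in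
  the same powers of the radical, so the left-hand side becomes \<open>(f x)\<^sub>i\<^sub>i\<close> times the nonzero image
  of the corner matrix unit.
\<close>

lemma alg_auto_diag:
  fixes f :: "'k::field mat \<Rightarrow> 'k mat"
  assumes f: "f \<in> alg_auto (UT_alg n)" and x: "x \<in> band n 0" and i: "i < n"
  shows "f x $$ (i, i) = x $$ (i, i)"
proof -
  let ?L = "matrix_unit n 0 i :: 'k mat" and ?R = "matrix_unit n i (n - 1) :: 'k mat"
    and ?E = "matrix_unit n 0 (n - 1) :: 'k mat"
  have b: "?L \<in> band n 0" "?R \<in> band n 0" "?E \<in> band n 0"
    using i by (auto intro!: matrix_unit_band)
  have L: "f ?L \<in> band n i" using alg_auto_superdiagonal[OF f, of 0 i] i by simp
  have R: "f ?R \<in> band n (n - 1 - i)" using alg_auto_superdiagonal[OF f, of i "n - 1 - i"] i by simp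
  have "?E \<noteq> 0\<^sub>m n n"
  proof
    assume "?E = 0\<^sub>m n n"
    then have "?E $$ (0, n - 1) = 0" using i by simp
    then show False using i by (simp add: matrix_unit_entry)
  qed
  then have E0: "f ?E \<noteq> 0\<^sub>m n n" using alg_autoD(5)[OF f b(3)] by blast
  have "?L * ?R = ?E" using i by (subst matrix_unit_mult) auto
  then have E: "f ?L * f ?R = f ?E" using alg_autoD(2)[OF f b(1,2)] by metis
  have Lx: "?L * x \<in> band n 0" using band_mult[OF b(1) x] by simp
  have "f x $$ (i, i) \<cdot>\<^sub>m f ?E = f ?L * f x * f ?R"
    using top_band_sandwich(1)[OF L R alg_autoD(1)[OF f x] i] E by simp
  also have "\<dots> = f (?L * x * ?R)"
    using alg_autoD(2)[OF f Lx b(2)] alg_autoD(2)[OF f b(1) x] by simp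
  also have "?L * x * ?R = x $$ (i, i) \<cdot>\<^sub>m ?E"
    using i by (intro matrix_unit_sandwich band_carrier[OF x]) auto
  also have "f \<dots> = x $$ (i, i) \<cdot>\<^sub>m f ?E"
    using alg_autoD(3)[OF f b(3)] .
  finally have eq: "f x $$ (i, i) \<cdot>\<^sub>m f ?E = x $$ (i, i) \<cdot>\<^sub>m f ?E" .
  have Ec: "f ?E \<in> carrier_mat n n" using alg_autoD(1)[OF f b(3)] by (rule band_carrier)
  obtain r s where rs: "r < n" "s < n" "f ?E $$ (r, s) \<noteq> 0"
    using E0 square_mat_eqI[OF Ec zero_carrier_mat] by (metis index_zero_mat(1))
  have "(f x $$ (i, i) \<cdot>\<^sub>m f ?E) $$ (r, s) = (x $$ (i, i) \<cdot>\<^sub>m f ?E) $$ (r, s)" using eq by simp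
  then show ?thesis using rs Ec by simp
qed

context UT_grading
begin

lemma grading_Aut_fixes_pieces:
  assumes f: "f \<in> grading_Aut G (UT_alg n) \<Gamma>" and g: "g \<in> carrier G"
  shows "f ` \<Gamma> g = \<Gamma> g"
proof (cases "\<Gamma> g = {0\<^sub>m n n}")
  case True
  then show ?thesis using f alg_autoD(4) by (auto simp: grading_Aut_def)
next
  case False
  have fa: "f \<in> alg_auto (UT_alg n)" using f by (simp add: grading_Aut_def)
  note fD = alg_autoD[OF fa]
  have perm: "\<exists>h\<in>carrier G. f ` \<Gamma> g = \<Gamma> h" if "g \<in> carrier G" "\<Gamma> g \<noteq> {0\<^sub>m n n}" for g
    using f that by (auto simp: grading_Aut_def grading_supp_def UT_alg_simps(4))
  obtain h where h: "h \<in> carrier G" "f ` \<Gamma> g = \<Gamma> h" using perm[OF g False] by blast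
  obtain a where a: "a \<in> \<Gamma> g" "a \<noteq> 0\<^sub>m n n" using False piece_zero[OF g] by blast
  have ab: "a \<in> band n 0" using piece_band[OF g] a by blast
  obtain u where u: "\<And>i. i < n \<Longrightarrow> u i \<in> \<Gamma> \<one> \<and> primitive_at n i (u i)"
    using homogeneous_primitive by metis
  then obtain i j where ij: "i < n" "j < n" and b0: "u i * a * u j \<noteq> 0\<^sub>m n n"
    using nonzero_corner[OF ab a(2), of u] by blast
  have ub: "u k \<in> band n 0" if "k < n" for k using u[OF that] by (simp add: primitive_at_def)
  have v: "f (u k) \<in> \<Gamma> \<one> \<and> primitive_at n k (f (u k))" if k: "k < n" for k
  proof
    have d: "f (u k) $$ (r, r) = (if r = k then 1 else 0)" if "r < n" for r
      using alg_auto_diag[OF fa ub[OF k] that] u[OF k] that by (simp add: primitive_at_def)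
    show "primitive_at n k (f (u k))"
      using d fD(1)[OF ub[OF k]] fD(2)[OF ub[OF k] ub[OF k]] u[OF k] by (simp add: primitive_at_def)
    have "\<Gamma> \<one> \<noteq> {0\<^sub>m n n}"
    proof
      assume "\<Gamma> \<one> = {0\<^sub>m n n}"
      then have "u k $$ (k, k) = 0" using u[OF k] k by simp
      then show False using u[OF k] k by (simp add: primitive_at_def)
    qed
    then obtain h1 where h1: "h1 \<in> carrier G" "f ` \<Gamma> \<one> = \<Gamma> h1" using perm by blast
    then have "f (u k) \<in> \<Gamma> h1" using u[OF k] by blast
    moreover from this have "h1 = \<one>"
      using diag_nonzero_imp_degree_one[of "f (u k)" h1 k] h1 k d[OF k] by simp
    ultimately show "f (u k) \<in> \<Gamma> \<one>" by simp
  qed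
  have vb: "f (u k) \<in> band n 0" if "k < n" for k using fD(1) ub that by blast
  have fab: "f a \<in> band n 0" using fD(1) ab .
  \<comment> \<open>Both \<open>b\<close> (degree \<open>g\<close>) and \<open>c\<close> (degree \<open>h\<close>) lie on the line spanned by \<open>w\<close>.\<close>
  define b where "b = u i * a * u j"
  define c where "c = u i * f b * u j"
  have ua: "u i * a \<in> band n 0" using band_mult[OF ub[OF ij(1)] ab] by simp
  have bb: "b \<in> band n 0" using band_mult[OF ua ub[OF ij(2)]] by (simp add: b_def)
  have bg: "b \<in> \<Gamma> g"
    using piece_mult[of \<one> g "u i" a] piece_mult[of g \<one> "u i * a" "u j"] u ij g a
    by (simp add: b_def)
  have fb: "f b = f (u i) * f a * f (u j)"
    using fD(2)[OF ua ub[OF ij(2)]] fD(2)[OF ub[OF ij(1)] ab] by (simp add: b_def)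
  have "f b \<in> \<Gamma> h" using bg h by blast
  then have ch: "c \<in> \<Gamma> h"
    using piece_mult[of \<one> h "u i" "f b"] piece_mult[of h \<one> "u i * f b" "u j"] u ij h(1)
    by (simp add: c_def)
  have C: "u i \<in> carrier_mat n n" "u j \<in> carrier_mat n n" "f (u i) \<in> carrier_mat n n"
    "f (u j) \<in> carrier_mat n n" "f a \<in> carrier_mat n n"
    using ub vb ij fab by (auto intro: band_carrier)
  have "f (u i) * c * f (u j) = (f (u i) * u i * f (u i)) * f a * (f (u j) * u j * f (u j))"
    using C by (simp add: c_def fb assoc_mult_mat[of _ n n _ n _ n] mult_carrier_mat[of _ n n])
  also have "\<dots> = f b"
    using primitive_sandwich[of n i "u i" "f (u i)"] primitive_sandwich[of n j "u j" "f (u j)"] u v ij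
    by (simp add: fb)
  finally have recover: "f (u i) * c * f (u j) = f b" .
  have c0: "c \<noteq> 0\<^sub>m n n"
  proof
    assume "c = 0\<^sub>m n n"
    then have "f b = 0\<^sub>m n n" using recover C by simp
    then show False using fD(5)[OF bb] b0 by (simp add: b_def)
  qed
  define w where "w = u i * matrix_unit n i j * u j"
  have bw: "b = b $$ (i, j) \<cdot>\<^sub>m w"
    using primitive_corner[of n i "u i" j "u j" a] u ij ab by (simp add: b_def w_def)
  have cw: "c = c $$ (i, j) \<cdot>\<^sub>m w"
    using primitive_corner[of n i "u i" j "u j" "f b"] u ij fD(1)[OF bb] by (simp add: c_def w_def)
  have wc: "w \<in> carrier_mat n n" using C by (simp add: w_def mult_carrier_mat[of _ n n])
  have "b $$ (i, j) \<noteq> 0"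
  proof
    assume "b $$ (i, j) = 0"
    then have "b = 0 \<cdot>\<^sub>m w" using bw by simp
    also have "\<dots> = 0\<^sub>m n n" using wc by (intro square_mat_eqI[of _ n]) auto
    finally have "b = 0\<^sub>m n n" .
    then show False using b0 by (simp add: b_def)
  qed
  then have "c = (c $$ (i, j) / b $$ (i, j)) \<cdot>\<^sub>m b"
    by (subst cw, subst (2) bw) (rule square_mat_eqI[of _ n], use wc in auto)
  then have "c \<in> \<Gamma> g" using piece_smult[OF g bg] by metis
  then have "g = h" using piece_disjoint ch c0 g h by blast
  then show ?thesis using h by simp
qed

lemma grading_Aut_eq_Stab: "grading_Aut G (UT_alg n) \<Gamma> = grading_Stab G (UT_alg n) \<Gamma>"
proof
  show "grading_Aut G (UT_alg n) \<Gamma> \<subseteq> grading_Stab G (UT_alg n) \<Gamma>"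
    using grading_Aut_fixes_pieces by (auto simp: grading_Stab_def grading_Aut_def)
  show "grading_Stab G (UT_alg n) \<Gamma> \<subseteq> grading_Aut G (UT_alg n) \<Gamma>"
    unfolding grading_Stab_def grading_Aut_def grading_supp_def by blast
qed

end

section \<open>The Weyl group\<close>

lemma subgroup_grading_Stab:
  assumes A: "ring A" "\<And>c x. x \<in> carrier A \<Longrightarrow> c \<odot>\<^bsub>A\<^esub> x \<in> carrier A"
    and \<Gamma>: "\<And>g. g \<in> carrier G \<Longrightarrow> \<Gamma> g \<subseteq> carrier A"
  shows "subgroup (grading_Stab G A \<Gamma>) (BijGroup (carrier A))"
proof -
  interpret ring A by (rule A(1))
  let ?S = "carrier A" and ?H = "grading_Stab G A \<Gamma>"
  have mem: "f \<in> ?H \<longleftrightarrow> f \<in> Bij ?S \<and> (\<forall>x\<in>?S. \<forall>y\<in>?S. f (x \<otimes>\<^bsub>A\<^esub> y) = f x \<otimes>\<^bsub>A\<^esub> f y \<and> f (x \<oplus>\<^bsub>A\<^esub> y) = f x \<oplus>\<^bsub>A\<^esub> f y)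
      \<and> f \<one>\<^bsub>A\<^esub> = \<one>\<^bsub>A\<^esub> \<and> (\<forall>c. \<forall>x\<in>?S. f (c \<odot>\<^bsub>A\<^esub> x) = c \<odot>\<^bsub>A\<^esub> f x) \<and> (\<forall>g\<in>carrier G. f ` \<Gamma> g = \<Gamma> g)" for f
    unfolding grading_Stab_def alg_auto_def Ring.ring_hom_def
    using Bij_imp_funcset[of f "carrier A"] by blast
  show ?thesis
  proof
    show "?H \<subseteq> carrier (BijGroup ?S)" by (auto simp: mem BijGroup_def)
  next
    fix f h assume fh: "f \<in> ?H" "h \<in> ?H"
    then have B: "f \<in> Bij ?S" "h \<in> Bij ?S" by (auto simp: mem)
    then have cl: "h x \<in> ?S" if "x \<in> ?S" for x using that Bij_imp_funcset by blast
    have "compose ?S f h ` \<Gamma> g = \<Gamma> g" if "g \<in> carrier G" for g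
    proof -
      have "compose ?S f h ` \<Gamma> g = f ` h ` \<Gamma> g"
        using \<Gamma>[OF that] by (force simp: compose_def image_image)
      then show ?thesis using fh that by (simp add: mem)
    qed
    then have "compose ?S f h \<in> ?H"
      using fh cl A(2) compose_Bij[OF B] by (simp add: mem compose_def)
    then show "f \<otimes>\<^bsub>BijGroup ?S\<^esub> h \<in> ?H" using B by (simp add: BijGroup_def)
  next
    have "(\<lambda>x\<in>?S. x) ` \<Gamma> g = \<Gamma> g" if "g \<in> carrier G" for g
      using \<Gamma>[OF that] by force
    then show "\<one>\<^bsub>BijGroup ?S\<^esub> \<in> ?H"
      using A(2) by (simp add: mem BijGroup_def id_Bij)
  next
    fix f assume f: "f \<in> ?H"
    then have B: "f \<in> Bij ?S" by (simp add: mem)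
    then have bij: "bij_betw f ?S ?S" by (simp add: Bij_def)
    let ?i = "inv_into ?S f"
    have icl: "?i x \<in> ?S" and fi: "f (?i x) = x" if "x \<in> ?S" for x
      using that bij by (auto simp: bij_betw_def inv_into_into f_inv_into_f)
    have inv: "?i y = x" if "x \<in> ?S" "f x = y" for x y
      using that bij by (auto simp: bij_betw_def)
    have "(\<lambda>x\<in>?S. ?i x) ` \<Gamma> g = \<Gamma> g" if g: "g \<in> carrier G" for g
    proof -
      have "(\<lambda>x\<in>?S. ?i x) ` \<Gamma> g = ?i ` f ` \<Gamma> g"
        using f g \<Gamma>[OF g] by (force simp: mem)
      also have "\<dots> = \<Gamma> g"
        using bij \<Gamma>[OF g] by (simp add: bij_betw_def inv_into_image_cancel)
      finally show ?thesis .
    qed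
    then have "(\<lambda>x\<in>?S. ?i x) \<in> ?H"
      using f icl fi A(2) restrict_inv_into_Bij[OF B]
      by (auto simp: mem intro!: inv)
    then show "inv\<^bsub>BijGroup ?S\<^esub> f \<in> ?H" using inv_BijGroup[OF B] by simp
  qed
qed

lemma (in group) self_factor_trivial: "trivial_group (G Mod carrier G)"
proof -
  interpret F: group "G Mod carrier G"
    using normal.factorgroup_is_group[OF normal_self] .
  have "carrier (G Mod carrier G) \<subseteq> {carrier G}"
    using coset_join2[OF _ subgroup_self] by (auto simp: FactGroup_def RCOSETS_def)
  then show ?thesis using F.trivial_group_alt by blast
qed

theorem proposition3:
  fixes G :: "('g, 'm) monoid_scheme"
    and n :: nat
    and \<Gamma> :: "'g \<Rightarrow> 'k::field mat set"
  assumes "group G"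
    and "alg_grading G (UT_alg n) \<Gamma>"
  shows "grading_Aut G (UT_alg n) \<Gamma> = grading_Stab G (UT_alg n) \<Gamma>
    \<and> trivial_group (Weyl_group G (UT_alg n) \<Gamma>)"
proof -
  interpret UT_grading G n \<Gamma>
    using assms by (simp add: UT_grading_def UT_grading_axioms_def)
  let ?A = "UT_alg n :: ('k, 'k mat) module"
  let ?H = "grading_Stab G ?A \<Gamma>" and ?B = "BijGroup (carrier ?A)"
  have "subgroup ?H ?B"
  proof (rule subgroup_grading_Stab[OF ring_UT_alg])
    show "c \<odot>\<^bsub>?A\<^esub> x \<in> carrier ?A" if "x \<in> carrier ?A" for c x
      using that by (simp add: carrier_UT_alg UT_alg_simps(6) band_smult)
    show "\<Gamma> g \<subseteq> carrier ?A" if "g \<in> carrier G" for g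
      using piece_band[OF that] by (auto simp: carrier_UT_alg)
  qed
  then have "group (?B\<lparr>carrier := ?H\<rparr>)"
    using group.subgroup_imp_group group_BijGroup by blast
  then have "trivial_group (Weyl_group G ?A \<Gamma>)"
    using group.self_factor_trivial[of "?B\<lparr>carrier := ?H\<rparr>"]
    by (simp add: Weyl_group_def grading_AutGroup_def grading_Aut_eq_Stab)
  then show ?thesis using grading_Aut_eq_Stab by simp
qed

end
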